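(* For each integer $n\ge 1$ and $0<r\le 1$ let $\mathbf{B}^n_r=\{x\in\mathbb{R}^n:|x|<r\}$ and $\mathbf{B}^n=\mathbf{B}^n_1$. Then, as $n\to\infty$, the volume of $\mathbf{B}^n$ tends to $0$ and gets concentrated near the boundary sphere $\partial\mathbf{B}^n=\{x\in\mathbb{R}^n:|x|=1\}$; that is, $$\lim_{n\to\infty}\mathrm{Vol}(\mathbf{B}^n)=0\qquad\text{and}\qquad \lim_{n\to\infty}\frac{\mathrm{Vol}(\mathbf{B}^n_r)}{\mathrm{Vol}(\mathbf{B}^n)}=0\quad\text{for every } r\in(0,1).$$
   Context: $|\cdot|$ is the Euclidean norm on $\mathbb{R}^n$ and $\mathrm{Vol}$ is $n$-dimensional Lebesgue measure. "Concentrated near the boundary sphere" means that for every fixed $r\in(0,1)$ the fraction of the total volume lying in the concentric ball $\mathbf{B}^n_r$ tends to $0$ as $n\to\infty$, so that the fraction in the shell $\mathbf{B}^n\setminus\mathbf{B}^n_r$ tends to $1$. *)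

theory Defs
  imports "HOL-Analysis.Analysis"
begin

text \<open>
  The dimension \<open>n\<close> tends to infinity, so it has to be a term rather than a type: a point of
  \<open>\<real>\<close>-to-the-\<open>n\<close> is a function on the index set \<open>{..<n}\<close>, extended by \<open>undefined\<close> outside it.
\<close>

definition euclidean_points :: "nat \<Rightarrow> (nat \<Rightarrow> real) set"
  where "euclidean_points n = ({..<n} \<rightarrow>\<^sub>E UNIV)"

definition euclidean_norm :: "nat \<Rightarrow> (nat \<Rightarrow> real) \<Rightarrow> real"
  where "euclidean_norm n x = L2_set x {..<n}"

text \<open>
  As for the library's \<^const>\<open>lebesgue\<close>, Lebesgue measure is the completion of the Borel version,
  which here is the \<open>n\<close>-fold product of one-dimensional \<^const>\<open>lborel\<close>.
\<close>

definition lebesgue_dim :: "nat \<Rightarrow> (nat \<Rightarrow> real) measure"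
  where "lebesgue_dim n = completion (\<Pi>\<^sub>M i\<in>{..<n}. lborel)"

definition Vol :: "nat \<Rightarrow> (nat \<Rightarrow> real) set \<Rightarrow> real"
  where "Vol n S = measure (lebesgue_dim n) S"

definition open_ball :: "nat \<Rightarrow> real \<Rightarrow> (nat \<Rightarrow> real) set"
  where "open_ball n r = {x \<in> euclidean_points n. euclidean_norm n x < r}"

abbreviation unit_ball :: "nat \<Rightarrow> (nat \<Rightarrow> real) set"
  where "unit_ball n \<equiv> open_ball n 1"

text \<open>
  \<^const>\<open>measure\<close> returns \<open>0\<close> on sets that are not measurable or have infinite measure; the
  first two facts below show that neither happens for the balls.  The third shows that no quotient
  by the volume of the unit ball is a division by zero.
\<close>

lemma open_ball_measurable:
  "open_ball n r \<in> sets (\<Pi>\<^sub>M i\<in>{..<n}. lborel)"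
proof -
  have "open_ball n r =
      {x \<in> space (\<Pi>\<^sub>M i\<in>{..<n}. lborel :: real measure). sqrt (\<Sum>i<n. (x i)\<^sup>2) < r}"
    by (simp add: open_ball_def euclidean_points_def euclidean_norm_def L2_set_def space_PiM)
  also have "\<dots> \<in> sets (\<Pi>\<^sub>M i\<in>{..<n}. lborel)"
    by measurable
  finally show ?thesis .
qed

lemma open_ball_finite_volume:
  "emeasure (lebesgue_dim n) (open_ball n r) < \<infinity>"
proof -
  interpret finite_product_sigma_finite "\<lambda>_. lborel :: real measure" "{..<n}"
    by unfold_locales auto
  have "open_ball n r \<subseteq> ({..<n} \<rightarrow>\<^sub>E {-\<bar>r\<bar>..\<bar>r\<bar>})"
  proof
    fix x assume x: "x \<in> open_ball n r"
    have "\<bar>x i\<bar> \<le> \<bar>r\<bar>" if "i < n" for i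
    proof -
      have "\<bar>x i\<bar> = L2_set x {i}"
        by simp
      also have "\<dots> \<le> L2_set x {..<n}"
        unfolding L2_set_def using that
        by (intro real_sqrt_le_mono sum_mono2) auto
      also have "\<dots> \<le> \<bar>r\<bar>"
        using x by (auto simp: open_ball_def euclidean_norm_def)
      finally show ?thesis .
    qed
    then show "x \<in> ({..<n} \<rightarrow>\<^sub>E {-\<bar>r\<bar>..\<bar>r\<bar>})"
      using x by (auto simp: open_ball_def euclidean_points_def PiE_iff abs_le_iff minus_le_iff)
  qed
  then have "emeasure (\<Pi>\<^sub>M i\<in>{..<n}. lborel) (open_ball n r)
      \<le> emeasure (\<Pi>\<^sub>M i\<in>{..<n}. lborel) ({..<n} \<rightarrow>\<^sub>E {-\<bar>r\<bar>..\<bar>r\<bar>})"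
    by (intro emeasure_mono sets_PiM_I_finite) auto
  also have "\<dots> = (\<Prod>i<n. emeasure lborel {-\<bar>r\<bar>..\<bar>r\<bar>})"
    by (intro measure_times) auto
  also have "\<dots> < \<infinity>"
    by (simp add: ennreal_power flip: top.not_eq_extremum)
  finally show ?thesis
    by (simp add: lebesgue_dim_def emeasure_completion open_ball_measurable)
qed

lemma unit_ball_volume_pos:
  "Vol n (unit_ball n) > 0"
proof -
  interpret finite_product_sigma_finite "\<lambda>_. lborel :: real measure" "{..<n}"
    by unfold_locales auto
  define a :: real where "a = 1 / (real n + 1)"
  have a: "a > 0" "real n * a < 1"
    by (auto simp: a_def field_simps)
  have "({..<n} \<rightarrow>\<^sub>E {-a..a}) \<subseteq> unit_ball n"
  proof
    fix x assume x: "x \<in> ({..<n} \<rightarrow>\<^sub>E {-a..a})"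
    have "L2_set x {..<n} \<le> (\<Sum>i<n. \<bar>x i\<bar>)"
      by (rule L2_set_le_sum_abs)
    also have "\<dots> \<le> (\<Sum>i<n. a)"
      using x by (intro sum_mono) (auto simp: PiE_iff abs_le_iff minus_le_iff)
    also have "\<dots> < 1"
      using a by simp
    finally show "x \<in> unit_ball n"
      using x by (auto simp: open_ball_def euclidean_points_def euclidean_norm_def PiE_iff)
  qed
  then have "emeasure (\<Pi>\<^sub>M i\<in>{..<n}. lborel) ({..<n} \<rightarrow>\<^sub>E {-a..a})
      \<le> emeasure (\<Pi>\<^sub>M i\<in>{..<n}. lborel) (unit_ball n)"
    by (intro emeasure_mono open_ball_measurable)
  moreover have "emeasure (\<Pi>\<^sub>M i\<in>{..<n}. lborel) ({..<n} \<rightarrow>\<^sub>E {-a..a})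
      = (\<Prod>i<n. emeasure lborel {-a..a})"
    by (intro measure_times) auto
  moreover have "\<dots> > 0"
    using a by (simp add: ennreal_power)
  ultimately have "emeasure (lebesgue_dim n) (unit_ball n) > 0"
    by (simp add: lebesgue_dim_def emeasure_completion open_ball_measurable)
  then show ?thesis
    using open_ball_finite_volume[of n 1]
    by (simp add: Vol_def measure_def enn2real_positive_iff)
qed

end

theory Submission imports Defs begin

text \<open>
  The volume of the ball of radius \<open>r > 0\<close> in dimension \<open>n\<close> is homogeneous: it equals
  \<open>\<omega> n * r ^ n\<close>, where the volume \<open>\<omega> n\<close> of the unit ball is
  \<open>\<pi> powr (n / 2) / \<Gamma> (n / 2 + 1)\<close>.  Both limits can be read off this formula.

  The volume of the unit ball tends to \<open>0\<close> because the Gamma function grows factorially and so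
  beats the exponential numerator: with \<open>k = n div 2\<close>, the volume is at most \<open>2 * \<pi> ^ k / k!\<close>,
  a constant times a term of the exponential series.  The volume concentrates near the
  sphere because the factor \<open>\<omega> n\<close> cancels in the quotient, which is exactly \<open>r ^ n\<close>.
\<close>

text \<open>
  The open ball inherits its volume from closed balls, for which
  \<open>emeasure_cball_aux\<close> gives this formula: it lies between the closed balls of radius
  \<open>s < r\<close> and \<open>r\<close>, and the formula is continuous in the radius.
\<close>

lemma Vol_open_ball:
  assumes "r > 0"
  shows "Vol n (open_ball n r) = unit_ball_vol (real n) * r ^ n"
proof -
  define M where "M = (\<Pi>\<^sub>M i\<in>{..<n}. lborel :: real measure)"
  define closed_ball where
    "closed_ball s = {f. sqrt (\<Sum>i<n. (f i)\<^sup>2) \<le> s} \<inter> space M" for s :: real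
  have closed: "emeasure M (closed_ball s) = ennreal (unit_ball_vol (real n) * s ^ n)"
    if "s > 0" for s
    using emeasure_cball_aux[of "{..<n}" s] that by (simp add: closed_ball_def M_def)
  have closed_sets: "closed_ball s \<in> sets M" for s
  proof -
    have "closed_ball s = {f \<in> space M. sqrt (\<Sum>i<n. (f i)\<^sup>2) \<le> s}"
      by (auto simp: closed_ball_def)
    also have "\<dots> \<in> sets M"
      unfolding M_def by measurable
    finally show ?thesis .
  qed
  have open_eq: "open_ball n r = {f \<in> space M. sqrt (\<Sum>i<n. (f i)\<^sup>2) < r}"
    by (simp add: open_ball_def euclidean_points_def euclidean_norm_def L2_set_def space_PiM M_def)
  have open_sets: "open_ball n r \<in> sets M"
    using open_ball_measurable by (simp add: M_def)
  have Vol: "ennreal (Vol n (open_ball n r)) = emeasure M (open_ball n r)"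
    using open_ball_finite_volume[of n r] open_sets
    by (simp add: Vol_def emeasure_eq_ennreal_measure lebesgue_dim_def emeasure_completion M_def)
  have "ennreal (Vol n (open_ball n r)) \<le> ennreal (unit_ball_vol (real n) * r ^ n)"
    unfolding Vol closed[OF assms, symmetric]
    by (intro emeasure_mono closed_sets) (auto simp: open_eq closed_ball_def)
  then have upper: "Vol n (open_ball n r) \<le> unit_ball_vol (real n) * r ^ n"
    using assms by (subst (asm) ennreal_le_iff) auto
  have lower: "unit_ball_vol (real n) * s ^ n \<le> Vol n (open_ball n r)" if "0 < s" "s < r" for s
  proof -
    have "ennreal (unit_ball_vol (real n) * s ^ n) \<le> ennreal (Vol n (open_ball n r))"
      unfolding Vol closed[OF \<open>0 < s\<close>, symmetric]
      using \<open>s < r\<close> by (intro emeasure_mono open_sets) (auto simp: open_eq closed_ball_def)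
    then show ?thesis
      by (subst (asm) ennreal_le_iff) (auto simp: Vol_def)
  qed
  have "((\<lambda>s. unit_ball_vol (real n) * s ^ n) \<longlongrightarrow> unit_ball_vol (real n) * r ^ n) (at_left r)"
    by (intro tendsto_intros)
  moreover have "\<forall>\<^sub>F s in at_left r. unit_ball_vol (real n) * s ^ n \<le> Vol n (open_ball n r)"
    using eventually_at_left_real[OF assms] by eventually_elim (simp add: lower)
  ultimately have "unit_ball_vol (real n) * r ^ n \<le> Vol n (open_ball n r)"
    by (intro tendsto_upperbound) auto
  with upper show ?thesis
    by simp
qed

text \<open>
  In even dimension \<open>2 * k\<close> the volume is \<open>\<pi> ^ k / k!\<close>; in dimension \<open>2 * k + 1\<close> the factorial
  is replaced by \<open>1/2 * (3/2) * \<dots> * (k + 1/2)\<close>, whose first factor accounts for the \<open>2\<close> in the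
  bound and whose remaining factors exceed those of \<open>k!\<close> one by one.
\<close>

lemma unit_ball_vol_le:
  "unit_ball_vol (real n) \<le> 2 * (pi ^ (n div 2) / fact (n div 2))"
proof (cases "even n")
  case True
  then obtain k where n: "n = 2 * k" ..
  have "(0::real) \<le> pi ^ k / fact k"
    by simp
  then show ?thesis
    unfolding n unit_ball_vol_even by (simp only: nonzero_mult_div_cancel_left)
next
  case False
  then obtain k where n: "n = 2 * k + 1"
    by (rule oddE)
  have "(fact k :: real) = (\<Prod>i<k. real (Suc i))"
    by (simp add: fact_prod_Suc atLeast0LessThan)
  also have "\<dots> \<le> (\<Prod>i<k. 1 / 2 + real (Suc i))"
    by (intro prod_mono) auto
  also have "\<dots> = 2 * pochhammer (1 / 2) (Suc k)"
    unfolding pochhammer_rec by (simp add: pochhammer_prod atLeast0LessThan add_ac)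
  finally have "(fact k :: real) \<le> 2 * pochhammer (1 / 2) (Suc k)" .
  then have "2 * pi ^ k / (2 * pochhammer (1 / 2) (Suc k)) \<le> 2 * pi ^ k / fact k"
    by (intro divide_left_mono) (auto intro!: mult_pos_pos pochhammer_pos)
  then show ?thesis
    unfolding n unit_ball_vol_odd' by simp
qed

lemma unit_ball_vol_tendsto_0: "(\<lambda>n. unit_ball_vol (real n)) \<longlonglongrightarrow> 0"
proof (rule tendsto_sandwich[OF _ _ tendsto_const])
  have "(\<lambda>k. pi ^ k / fact k) \<longlonglongrightarrow> 0"
    using summable_LIMSEQ_zero[OF summable_exp[of pi]] by (simp add: field_simps)
  moreover have "filterlim (\<lambda>n::nat. n div 2) at_top at_top"
    by (rule filterlim_at_top_div_const_nat) simp
  ultimately have "(\<lambda>n. pi ^ (n div 2) / fact (n div 2)) \<longlonglongrightarrow> 0"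
    by (rule filterlim_compose)
  then show "(\<lambda>n. 2 * (pi ^ (n div 2) / fact (n div 2))) \<longlonglongrightarrow> 0"
    by (rule tendsto_mult_right_zero)
qed (intro always_eventually allI unit_ball_vol_le unit_ball_vol_nonneg of_nat_0_le_iff)+

theorem theorem1p1:
  shows "(\<lambda>n. Vol n (unit_ball n)) \<longlonglongrightarrow> 0 \<and>
         (\<forall>r::real. 0 < r \<and> r < 1 \<longrightarrow>
            (\<lambda>n. Vol n (open_ball n r) / Vol n (unit_ball n)) \<longlonglongrightarrow> 0)"
proof (intro conjI allI impI)
  show "(\<lambda>n. Vol n (unit_ball n)) \<longlonglongrightarrow> 0"
    using unit_ball_vol_tendsto_0 by (simp add: Vol_open_ball)
next
  fix r :: real
  assume r: "0 < r \<and> r < 1"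
  have "Vol n (open_ball n r) / Vol n (unit_ball n) = r ^ n" for n
    using r unit_ball_vol_pos[of "real n"] by (simp add: Vol_open_ball less_imp_neq[symmetric])
  then show "(\<lambda>n. Vol n (open_ball n r) / Vol n (unit_ball n)) \<longlonglongrightarrow> 0"
    using r by (simp add: LIMSEQ_realpow_zero)
qed

end
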